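(* Let $G$ be a finite undirected graph whose vertex set is partitioned into two sets $S$ and $Y$. Let $\mathcal{H}=(H_1,\dots,H_k)$ be a family of sets of directed paths, where each $H_i$ is a set of pairwise vertex-disjoint directed $S$–$S$ paths in $G$. If $\lVert\mathcal{H}\rVert=\sum_{i=1}^k|H_i|>2|Y|$, then there exists a strongly rainbow directed $S$–$S$ path in $G$.
   Context: Paths are (simple) paths in the undirected graph $G$, traversed in a chosen direction; $in(P)$ and $ter(P)$ denote the initial and terminal vertices of a directed path $P$. A directed $S$–$S$ path is a directed path $P$ (with at least one edge) with $in(P),ter(P)\in S$ and $V(P)\cap S=\{in(P),ter(P)\}$. The family $\mathcal{H}$ is a multiset (its members need not be distinct or disjoint). A path $P$ is strongly rainbow with respect to $\mathcal{H}$ if each of its edges can be chosen from a path belonging to a different member $H_i$ of $\mathcal{H}$, i.e. there is an injection assigning to each edge $e$ of $P$ an index $i$ and a path $Q\in H_i$ with $e\in E(Q)$. *)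

theory Defs
  imports "Graph_Theory.Arc_Walk"
begin

text \<open>
  A finite undirected (simple) graph is an instance of the locale \<open>graph\<close>, i.e. a finite loopless
  digraph without parallel arcs that has with each arc also the reverse one; the two arcs are the
  two directions in which an undirected edge can be traversed. A directed path with at least one
  edge is a nonempty arc list satisfying \<open>apath\<close>. Such a list determines the sequence of vertices
  it visits, and conversely. For a path \<open>P\<close>, \<open>set P\<close> is the set of its edges, each with the
  direction in which \<open>P\<close> traverses it.
\<close>

text \<open>The following functions are only meaningful for nonempty arc lists.\<close>

definition path_in :: "('a, 'b) pre_digraph \<Rightarrow> 'b list \<Rightarrow> 'a" where
  "path_in G P = tail G (hd P)"

definition path_ter :: "('a, 'b) pre_digraph \<Rightarrow> 'b list \<Rightarrow> 'a" where
  "path_ter G P = head G (last P)"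

definition path_verts :: "('a, 'b) pre_digraph \<Rightarrow> 'b list \<Rightarrow> 'a set" where
  "path_verts G P = set (pre_digraph.awalk_verts G (path_in G P) P)"

definition SS_path :: "('a, 'b) pre_digraph \<Rightarrow> 'a set \<Rightarrow> 'b list \<Rightarrow> bool" where
  "SS_path G S P \<longleftrightarrow>
     P \<noteq> [] \<and> pre_digraph.apath G (path_in G P) P (path_ter G P) \<and>
     path_in G P \<in> S \<and> path_ter G P \<in> S \<and>
     path_verts G P \<inter> S = {path_in G P, path_ter G P}"

definition vertex_disjoint :: "('a, 'b) pre_digraph \<Rightarrow> 'b list set \<Rightarrow> bool" where
  "vertex_disjoint G A \<longleftrightarrow> pairwise (\<lambda>P Q. path_verts G P \<inter> path_verts G Q = {}) A"

text \<open>
  A family \<open>(H\<^sub>1, \<dots>, H\<^sub>k)\<close> is a function on the index set \<open>{1..k}\<close>, so that a set of paths may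
  occur in it several times. In a strongly rainbow path, distinct edges get distinct indices.
\<close>

definition strongly_rainbow :: "nat \<Rightarrow> (nat \<Rightarrow> 'b list set) \<Rightarrow> 'b list \<Rightarrow> bool" where
  "strongly_rainbow k H P \<longleftrightarrow>
     (\<exists>c. inj_on c (set P) \<and> (\<forall>e\<in>set P. c e \<in> {1..k} \<and> (\<exists>Q\<in>H (c e). e \<in> set Q)))"

end

theory Submission
  imports Defs
begin

text \<open>
  Process the members of the family one after the other, and record for every vertex \<open>v\<close> the set
  of roots in \<open>S\<close> from which a strongly rainbow walk using only the members seen so far and
  meeting \<open>S\<close> at most in its endpoints leads to \<open>v\<close>. Suppose there is no strongly rainbow
  \<open>S\<close>--\<open>S\<close> path. Each path of the next member leads from a vertex \<open>s\<close> with root set \<open>{s}\<close> to a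
  vertex \<open>t \<noteq> s\<close> with root set \<open>{t}\<close>, so one of its arcs goes from a vertex with a root other than
  \<open>t\<close> to a vertex with no root other than \<open>t\<close>. The latter lies outside \<open>S\<close>, had at most one root,
  and gains a new one. As the paths of one member are disjoint, the sum of \<open>min 2\<close> of the numbers of
  roots over all vertices in \<open>Y\<close> grows by at least the size of that member; but it never exceeds
  \<open>2 |Y|\<close>.
\<close>

section \<open>Strongly rainbow arc lists\<close>

lemma strongly_rainbow_Nil [simp]: "strongly_rainbow k H []"
  by (simp add: strongly_rainbow_def)

lemma strongly_rainbow_mono:
  assumes "strongly_rainbow i H p" "set q \<subseteq> set p" "i \<le> j"
  shows "strongly_rainbow j H q"
proof -
  obtain c where "inj_on c (set p)"
    and c: "\<And>e. e \<in> set p \<Longrightarrow> c e \<in> {1..i} \<and> (\<exists>Q\<in>H (c e). e \<in> set Q)"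
    using assms(1) unfolding strongly_rainbow_def by blast
  then have "inj_on c (set q)" using assms(2) inj_on_subset by blast
  moreover have "\<forall>e\<in>set q. c e \<in> {1..j} \<and> (\<exists>Q\<in>H (c e). e \<in> set Q)"
    using c assms(2,3) by fastforce
  ultimately show ?thesis unfolding strongly_rainbow_def by blast
qed

lemma strongly_rainbow_snoc:
  assumes "strongly_rainbow i H p" "Q \<in> H (Suc i)" "e \<in> set Q"
  shows "strongly_rainbow (Suc i) H (p @ [e])"
proof (cases "e \<in> set p")
  case True
  \<comment> \<open>Indices are assigned to the set of arcs, so a repeated arc needs no new
    one.\<close>
  then show ?thesis using strongly_rainbow_mono[OF assms(1), of "p @ [e]" "Suc i"] by auto
next
  case False
  obtain c where inj: "inj_on c (set p)"
    and c: "\<And>e. e \<in> set p \<Longrightarrow> c e \<in> {1..i} \<and> (\<exists>Q\<in>H (c e). e \<in> set Q)"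
    using assms(1) unfolding strongly_rainbow_def by blast
  define d where "d = c(e := Suc i)"
  have d_old: "d x = c x" if "x \<in> set p" for x using that False by (auto simp: d_def)
  have "inj_on d (set p)" using inj d_old by (simp cong: inj_on_cong)
  \<comment> \<open>The old indices lie in \<open>{1..i}\<close>, so \<open>Suc i\<close> is
    fresh.\<close>
  moreover have "d e \<notin> d ` set p" using c d_old by (fastforce simp: d_def)
  ultimately have "inj_on d (set (p @ [e]))" using False by simp
  moreover have "d x \<in> {1..Suc i} \<and> (\<exists>Q\<in>H (d x). x \<in> set Q)" if "x \<in> set (p @ [e])" for x
    using that c[of x] d_old[of x] assms(2,3) by (cases "x = e") (auto simp: d_def)
  ultimately show ?thesis unfolding strongly_rainbow_def by blast
qed

text \<open>Walks instead of paths: appending an arc then needs no check that the new vertex is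
  unvisited. A path is extracted only once S is reached again.\<close>

definition rainbow_roots ::
    "('a, 'b) pre_digraph \<Rightarrow> 'a set \<Rightarrow> (nat \<Rightarrow> 'b list set) \<Rightarrow> nat \<Rightarrow> 'a \<Rightarrow> 'a set" where
  "rainbow_roots G S H i v =
     {r \<in> S. \<exists>p. pre_digraph.awalk G r p v \<and>
        set (pre_digraph.awalk_verts G r p) \<inter> S \<subseteq> {r} \<and> strongly_rainbow i H p}"

lemma rainbow_roots_mono: "i \<le> j \<Longrightarrow> rainbow_roots G S H i v \<subseteq> rainbow_roots G S H j v"
  unfolding rainbow_roots_def using strongly_rainbow_mono[OF _ order_refl] by blast

section \<open>Walks witnessing roots\<close>

context wf_digraph
begin

lemma path_verts_awalk:
  assumes "awalk u P v" "P \<noteq> []"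
  shows "path_verts G P = set (awalk_verts u P)" "path_in G P = u" "path_ter G P = v"
proof -
  from assms show "path_in G P = u" by (cases P) (auto simp: path_in_def awalk_simps)
  then show "path_verts G P = set (awalk_verts u P)" by (simp add: path_verts_def)
  from assms(1) have "awlast u P = v" by blast
  then show "path_ter G P = v" using assms(2) by (simp add: path_ter_def awalk_verts_conv)
qed

lemma SS_pathI:
  assumes "apath u P v" "P \<noteq> []" "u \<in> S" "v \<in> S" "set (awalk_verts u P) \<inter> S \<subseteq> {u, v}"
  shows "SS_path G S P"
proof -
  have w: "awalk u P v" using assms(1) by (rule awalkI_apath)
  then have "u \<in> set (awalk_verts u P)" "v \<in> set (awalk_verts u P)"
    by (metis awalkE awalk_verts_non_Nil hd_in_set last_in_set)+
  then show ?thesis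
    using assms path_verts_awalk[OF w assms(2)] by (auto simp: SS_path_def)
qed

lemma awalk_to_apath_verts_subset:
  assumes "awalk u p v"
  shows "set (awalk_verts u (awalk_to_apath p)) \<subseteq> set (awalk_verts u p)"
proof -
  have "awalk u (awalk_to_apath p) v"
    using apath_awalk_to_apath[OF assms] by (rule awalkI_apath)
  then show ?thesis
    using awalk_to_apath_subset[OF assms] set_awalk_verts[OF assms] set_awalk_verts by auto
qed

lemma awalk_leaves_set:
  assumes "awalk u p v" "u \<in> A" "v \<notin> A"
  shows "\<exists>e\<in>set p. tail G e \<in> A \<and> head G e \<notin> A"
  using assms by (induction p arbitrary: u) (auto simp: awalk_simps)

text \<open>The end of a witnessing walk is on the walk, so if it lies in S it must be the root; the
  empty walk witnesses that root. Hence root sets change only outside S.\<close>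

lemma rainbow_roots_in:
  assumes "v \<in> S" "v \<in> verts G"
  shows "rainbow_roots G S H i v = {v}"
proof
  show "rainbow_roots G S H i v \<subseteq> {v}"
  proof
    fix r assume "r \<in> rainbow_roots G S H i v"
    then obtain p where p: "awalk r p v" "set (awalk_verts r p) \<inter> S \<subseteq> {r}"
      unfolding rainbow_roots_def by blast
    from p(1) have "v \<in> set (awalk_verts r p)"
      by (metis awalkE awalk_verts_non_Nil last_in_set)
    then show "r \<in> {v}" using p(2) assms(1) by auto
  qed
  have "awalk v [] v" using assms(2) by (simp add: awalk_Nil_iff)
  then show "{v} \<subseteq> rainbow_roots G S H i v"
    using assms(1) unfolding rainbow_roots_def by (auto intro!: exI[of _ "[]"])
qed

lemma rainbow_roots_step:
  assumes "r \<in> rainbow_roots G S H i (tail G e)" "e \<in> arcs G"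
    and "Q \<in> H (Suc i)" "e \<in> set Q"
  shows "\<exists>p. awalk r p (head G e) \<and> set (awalk_verts r p) \<inter> S \<subseteq> {r, head G e} \<and>
    strongly_rainbow (Suc i) H p"
proof -
  obtain p where p: "awalk r p (tail G e)" "set (awalk_verts r p) \<inter> S \<subseteq> {r}"
    "strongly_rainbow i H p"
    using assms(1) unfolding rainbow_roots_def by blast
  have e: "awalk (tail G e) [e] (head G e)" using assms(2) by (rule arc_implies_awalk)
  have "tail G e \<in> set (awalk_verts r p)"
    using p(1) by (metis awalkE awalk_verts_non_Nil last_in_set)
  have w: "awalk r (p @ [e]) (head G e)" using p(1) e by (rule awalk_appendI)
  have "set (awalk_verts r (p @ [e])) \<inter> S \<subseteq> {r, head G e}"
    using set_awalk_verts_append[OF p(1) e] p(2) \<open>tail G e \<in> set (awalk_verts r p)\<close> by auto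
  with w show ?thesis using strongly_rainbow_snoc[OF p(3) assms(3,4)] by blast
qed

lemma rainbow_roots_step_outside:
  assumes "r \<in> rainbow_roots G S H i (tail G e)" "e \<in> arcs G" "head G e \<notin> S"
    and "Q \<in> H (Suc i)" "e \<in> set Q"
  shows "r \<in> rainbow_roots G S H (Suc i) (head G e)"
proof -
  have "r \<in> S" using assms(1) by (simp add: rainbow_roots_def)
  then show ?thesis
    using rainbow_roots_step[OF assms(1,2,4,5)] assms(3) unfolding rainbow_roots_def by blast
qed

lemma rainbow_SS_path_of_step:
  assumes r: "r \<in> rainbow_roots G S H i (tail G e)" and "e \<in> arcs G"
    and "head G e \<in> S" "r \<noteq> head G e"
    and "Q \<in> H (Suc i)" "e \<in> set Q"
  shows "\<exists>P. SS_path G S P \<and> strongly_rainbow (Suc i) H P"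
proof -
  obtain p where p: "awalk r p (head G e)" "set (awalk_verts r p) \<inter> S \<subseteq> {r, head G e}"
    "strongly_rainbow (Suc i) H p"
    using rainbow_roots_step[OF r assms(2,5,6)] by blast
  let ?P = "awalk_to_apath p"
  have P: "apath r ?P (head G e)" using p(1) by (rule apath_awalk_to_apath)
  \<comment> \<open>Shortcutting a walk with distinct ends cannot remove every arc.\<close>
  have "?P \<noteq> []" using P assms(4) by (auto simp: apath_Nil_iff)
  moreover have "r \<in> S" using r by (simp add: rainbow_roots_def)
  ultimately have "SS_path G S ?P"
    using awalk_to_apath_verts_subset[OF p(1)] p(2) by (intro SS_pathI[OF P _ _ assms(3)]) auto
  moreover have "strongly_rainbow (Suc i) H ?P"
    using p(3) awalk_to_apath_subset[OF p(1)] by (rule strongly_rainbow_mono) simp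
  ultimately show ?thesis by blast
qed

end

section \<open>Growth of the capped root count\<close>

context fin_digraph
begin

lemma finite_rainbow_roots: "finite (rainbow_roots G S H i v)"
  by (rule finite_subset[of _ "verts G"]) (auto simp: rainbow_roots_def awalk_def)

lemma SS_path_gains_root:
  assumes Q: "SS_path G S Q" "Q \<in> H (Suc i)"
    and no_path: "\<not> (\<exists>P. SS_path G S P \<and> strongly_rainbow (Suc i) H P)"
  shows "\<exists>v\<in>path_verts G Q - S. min 2 (card (rainbow_roots G S H i v))
    < min 2 (card (rainbow_roots G S H (Suc i) v))"
proof -
  define s t where "s = path_in G Q" and "t = path_ter G Q"
  let ?R = "rainbow_roots G S H"
  have ap: "apath s Q t" and st: "s \<in> S" "t \<in> S" "path_verts G Q \<inter> S = {s, t}" and "Q \<noteq> []"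
    using Q(1) unfolding SS_path_def s_def t_def by auto
  \<comment> \<open>Distinctness of the ends comes from simplicity of the nonempty path.\<close>
  then have "s \<noteq> t" using apath_nonempty_ends by blast
  have w: "awalk s Q t" using ap by (rule awalkI_apath)
  then have R: "?R i s = {s}" "?R i t = {t}"
    using st rainbow_roots_in awalk_hd_in_verts awalk_last_in_verts by metis+
  \<comment> \<open>\<open>s\<close> has the root \<open>s\<close>, which differs from
    \<open>t\<close>, while \<open>t\<close> has only itself, so \<open>Q\<close> must leave the set
    of vertices with a root other than \<open>t\<close>.\<close>
  obtain e where e: "e \<in> set Q" "\<not> ?R i (tail G e) \<subseteq> {t}" "?R i (head G e) \<subseteq> {t}"
    using awalk_leaves_set[OF w, of "{v. \<not> ?R i v \<subseteq> {t}}"] R \<open>s \<noteq> t\<close> by auto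
  then obtain r where r: "r \<in> ?R i (tail G e)" "r \<noteq> t" by blast
  have arc: "e \<in> arcs G" using w e(1) by auto
  have v: "head G e \<in> path_verts G Q"
    using w e(1) path_verts_awalk[OF w \<open>Q \<noteq> []\<close>] set_awalk_verts[OF w] by auto
  have "head G e \<notin> S"
  proof
    assume "head G e \<in> S"
    moreover have "head G e \<noteq> s" using e(3) R \<open>s \<noteq> t\<close> by auto
    ultimately have "head G e = t" using v st(3) by auto
    then show False
      using rainbow_SS_path_of_step[OF r(1) arc _ _ Q(2) e(1)] r(2) st(2) no_path by auto
  qed
  moreover from this have "r \<in> ?R (Suc i) (head G e)"
    using rainbow_roots_step_outside[OF r(1) arc _ Q(2) e(1)] by blast
  then have "?R i (head G e) \<subset> ?R (Suc i) (head G e)"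
    using rainbow_roots_mono[of i "Suc i" G S H "head G e"] e(3) r(2) by auto
  then have "card (?R i (head G e)) < card (?R (Suc i) (head G e))"
    by (intro psubset_card_mono finite_rainbow_roots)
  \<comment> \<open>With at most one old root, the cap 2 does not hide the gain.\<close>
  moreover have "card (?R i (head G e)) \<le> 1"
    using card_mono[OF _ e(3)] by simp
  ultimately show ?thesis using v by (intro bexI[of _ "head G e"]) auto
qed

lemma sum_roots_step:
  assumes SS: "\<And>P. P \<in> H (Suc i) \<Longrightarrow> SS_path G S P" and disj: "vertex_disjoint G (H (Suc i))"
    and no_path: "\<not> (\<exists>P. SS_path G S P \<and> strongly_rainbow (Suc i) H P)"
  shows "(\<Sum>v\<in>verts G - S. min 2 (card (rainbow_roots G S H i v))) + card (H (Suc i))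
    \<le> (\<Sum>v\<in>verts G - S. min 2 (card (rainbow_roots G S H (Suc i) v)))"
proof -
  let ?f = "\<lambda>i v. min 2 (card (rainbow_roots G S H i v))"
  have "\<forall>Q\<in>H (Suc i). \<exists>v\<in>path_verts G Q - S. ?f i v < ?f (Suc i) v"
    using SS_path_gains_root[OF SS _ no_path] by blast
  then obtain w where w: "\<And>Q. Q \<in> H (Suc i) \<Longrightarrow>
      w Q \<in> path_verts G Q - S \<and> ?f i (w Q) < ?f (Suc i) (w Q)"
    by metis
  have inj: "inj_on w (H (Suc i))"
  proof (rule inj_onI, rule ccontr)
    fix P Q assume "P \<in> H (Suc i)" "Q \<in> H (Suc i)" "w P = w Q" "P \<noteq> Q"
    then show False
      using disj w[of P] w[of Q] unfolding vertex_disjoint_def pairwise_def by auto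
  qed
  have sub: "w ` H (Suc i) \<subseteq> verts G - S"
  proof
    fix v assume "v \<in> w ` H (Suc i)"
    then obtain Q where Q: "Q \<in> H (Suc i)" "v = w Q" by blast
    then have "awalk (path_in G Q) Q (path_ter G Q)"
      using SS[OF Q(1)] awalkI_apath unfolding SS_path_def by blast
    then have "path_verts G Q \<subseteq> verts G" unfolding path_verts_def by auto
    then show "v \<in> verts G - S" using w[OF Q(1)] Q(2) by auto
  qed
  have fin: "finite (verts G - S)" by simp
  \<comment> \<open>Counting paths by their chosen vertices reduces the claim to one inequality per
    vertex: strict growth at chosen vertices, monotonicity elsewhere.\<close>
  have "card (H (Suc i)) = (\<Sum>v\<in>verts G - S. if v \<in> w ` H (Suc i) then 1 else 0)"
    using card_image[OF inj] sub fin by (simp add: sum.If_cases Int_absorb1)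
  moreover have "?f i v + (if v \<in> w ` H (Suc i) then 1 else 0) \<le> ?f (Suc i) v" for v
  proof (cases "v \<in> w ` H (Suc i)")
    case True
    then show ?thesis using w by fastforce
  next
    case False
    have "card (rainbow_roots G S H i v) \<le> card (rainbow_roots G S H (Suc i) v)"
      by (intro card_mono finite_rainbow_roots rainbow_roots_mono) simp
    with False show ?thesis by simp
  qed
  ultimately show ?thesis by (simp add: sum.distrib[symmetric] sum_mono)
qed

lemma sum_roots_ge:
  assumes SS: "\<And>i. i \<in> {1..k} \<Longrightarrow> \<forall>P\<in>H i. SS_path G S P"
    and disj: "\<And>i. i \<in> {1..k} \<Longrightarrow> vertex_disjoint G (H i)"
    and no_path: "\<not> (\<exists>P. SS_path G S P \<and> strongly_rainbow k H P)"
  shows "(\<Sum>i=1..k. card (H i)) \<le> (\<Sum>v\<in>verts G - S. min 2 (card (rainbow_roots G S H k v)))"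
  using assms
proof (induction k)
  case 0
  then show ?case by simp
next
  case (Suc k)
  have sub: "{1..k} \<subseteq> {1..Suc k}" by simp
  \<comment> \<open>A path that is rainbow for a shorter initial segment of the family stays rainbow
    for a longer one.\<close>
  have "\<not> (\<exists>P. SS_path G S P \<and> strongly_rainbow k H P)"
    using Suc.prems(3) strongly_rainbow_mono[OF _ order_refl, of k H _ "Suc k"] by auto
  then have "(\<Sum>i=1..k. card (H i))
      \<le> (\<Sum>v\<in>verts G - S. min 2 (card (rainbow_roots G S H k v)))"
    using Suc.prems(1,2) sub by (intro Suc.IH) blast+
  moreover have "(\<Sum>v\<in>verts G - S. min 2 (card (rainbow_roots G S H k v))) + card (H (Suc k))
      \<le> (\<Sum>v\<in>verts G - S. min 2 (card (rainbow_roots G S H (Suc k) v)))"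
    using Suc.prems by (intro sum_roots_step) auto
  ultimately show ?case by simp
qed

end

theorem theorem1p7:
  fixes G :: "('a, 'b) pre_digraph" and S Y :: "'a set"
    and k :: nat and H :: "nat \<Rightarrow> 'b list set"
  assumes "graph G"
    and "verts G = S \<union> Y" and "S \<inter> Y = {}"
    and "\<And>i P. i \<in> {1..k} \<Longrightarrow> P \<in> H i \<Longrightarrow> SS_path G S P"
    and "\<And>i. i \<in> {1..k} \<Longrightarrow> vertex_disjoint G (H i)"
    and "(\<Sum>i=1..k. card (H i)) > 2 * card Y"
  shows "\<exists>P. SS_path G S P \<and> strongly_rainbow k H P"
proof (rule ccontr)
  interpret graph G by fact
  have Y: "verts G - S = Y" using assms(2,3) by blast
  assume "\<not> ?thesis"
  then have "(\<Sum>i=1..k. card (H i)) \<le> (\<Sum>v\<in>Y. min 2 (card (rainbow_roots G S H k v)))"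
    using sum_roots_ge[of k H S] assms(4,5) unfolding Y by blast
  also have "\<dots> \<le> (\<Sum>v\<in>Y. 2)" by (intro sum_mono) simp
  finally show False using assms(6) by simp
qed

end
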